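(* Let $X,Y$ be locally convex spaces, $\mathcal{C}\subseteq Y$ a nonempty closed convex set such that $\mathcal{C}^\circ$ is weak$^\ast$-compact, $h\in\Gamma_0(X)$, $\varphi\in\Gamma_h(X)$ and $\Phi\in\Gamma_h(X,Y,\mathcal{C}^\circ)$. Let $\bar x$ be a feasible point of the problem $\min\varphi(x)$ s.t. $\Phi(x)\in\mathcal{C}$ such that, for all $\eta\ge0$ small enough, $$\partial_\eta h(\bar x)\subseteq\bigcup\Big[\alpha_1\,\partial_{\eta_1}(\varphi+h)(\bar x)+\alpha_2\,\partial_{\eta_2}\big(\langle\lambda^\ast,\Phi\rangle+h\big)(\bar x)\Big],$$ where the union is taken over all $\eta_1,\eta_2\ge0$, $(\alpha_1,\alpha_2)\in\Delta_2$ and $\lambda^\ast\in\mathcal{C}^\circ$ such that $\alpha_1\eta_1+\alpha_2(\eta_2+1-\langle\lambda^\ast,\Phi(\bar x)\rangle)=\eta$. In addition, suppose that $h$ is continuous at $\bar x$ and that the following qualification condition holds: $$\partial h(\bar x)\cap\bigcup\big[\partial\big(\langle\lambda^\ast,\Phi\rangle+h\big)(\bar x):\lambda^\ast\in N_{\mathcal{C}}(\Phi(\bar x)),\ \langle\lambda^\ast,\Phi(\bar x)\rangle=1\big]=\emptyset.$$ Then $\bar x$ is a local solution of the problem $\min\varphi(x)$ s.t. $\Phi(x)\in\mathcal{C}$.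
   Context: $X,Y$ are real Hausdorff locally convex spaces with topological duals $X^\ast,Y^\ast$; $Y$ is enlarged by an extra element $\infty_Y$. For $F:X\to Y\cup\{\infty_Y\}$, $\operatorname{dom}F=\{x: F(x)\in Y\}$, and for $y^\ast\in Y^\ast$ the function $\langle y^\ast,F\rangle:X\to\mathbb{R}\cup\{+\infty\}$ equals $\langle y^\ast,F(x)\rangle$ if $x\in\operatorname{dom}F$ and $+\infty$ otherwise. $\Gamma_0(X)$ is the set of proper convex lower semicontinuous functions $X\to\mathbb{R}\cup\{+\infty\}$. For $h\in\Gamma_0(X)$: $\Gamma_h(X)$ is the set of $f:X\to\mathbb{R}\cup\{+\infty\}$ with $\operatorname{dom}f\subseteq\operatorname{dom}h$ and $f+h\in\Gamma_0(X)$; for nonempty $B\subseteq Y^\ast$, $\Gamma_h(X,Y,B)$ is the set of $F:X\to Y\cup\{\infty_Y\}$ with $\operatorname{dom}F\subseteq\operatorname{dom}h$ and $\langle\lambda^\ast,F\rangle+h\in\Gamma_0(X)$ for all $\lambda^\ast\in B$. The polar is $\mathcal{C}^\circ=\{y^\ast\in Y^\ast:\langle y^\ast,y\rangle\le1\ \forall y\in\mathcal{C}\}$; the normal cone at $u\in\mathcal{C}$ is $N_{\mathcal C}(u)=\{y^\ast\in Y^\ast:\langle y^\ast,y-u\rangle\le0\ \forall y\in\mathcal{C}\}$. For $\epsilon\ge0$ and $f:X\to\overline{\mathbb R}$, $\partial_\epsilon f(x)=\{x^\ast\in X^\ast:\langle x^\ast,y-x\rangle\le f(y)-f(x)+\epsilon\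 \forall y\in X\}$ if $f(x)\in\mathbb{R}$, and $\partial_\epsilon f(x)=\emptyset$ otherwise; $\partial f=\partial_0f$. $\Delta_2=\{(\alpha_1,\alpha_2)\in[0,1]^2:\alpha_1+\alpha_2=1\}$. Set conventions: $A+\emptyset=\emptyset+A=\emptyset$ and $0\,\emptyset=\{0\}$. A feasible point is an $x$ with $\Phi(x)\in\mathcal{C}$; a local solution is a feasible $\bar x$ having a neighbourhood $U$ with $\varphi(\bar x)\le\varphi(x)$ for all feasible $x\in U$. *)

theory Defs
  imports "HOL-Analysis.Analysis"
begin

section \<open>Locally convex spaces and their duals\<close>

text \<open>Real Hausdorff locally convex spaces. The Hausdorff property is class \<^class>\<open>t2_space\<close>.\<close>

class locally_convex_space = real_vector + t2_space + topological_ab_group_add +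
  assumes tendsto_scaleR_nhds_Pair:
      "LIM p (nhds a \<times>\<^sub>F nhds b). scaleR (fst p) (snd p) :> nhds (scaleR a b)"
    and locally_convex_nhds_0:
      "open U \<Longrightarrow> 0 \<in> U \<Longrightarrow>
        \<exists>V. open V \<and> 0 \<in> V \<and> V \<subseteq> U \<and>
          (\<forall>x\<in>V. \<forall>y\<in>V. \<forall>u\<ge>0. \<forall>v\<ge>0. u + v = 1 \<longrightarrow> scaleR u x + scaleR v y \<in> V)"

instance real_normed_vector \<subseteq> locally_convex_space
proof
  fix a :: real and b :: 'a
  show "LIM p (nhds a \<times>\<^sub>F nhds b). fst p *\<^sub>R snd p :> nhds (a *\<^sub>R b)"
    by (intro tendsto_scaleR filterlim_fst filterlim_snd)
next
  fix U :: "'a set"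
  assume "open U" "0 \<in> U"
  then obtain e where "e > 0" "ball 0 e \<subseteq> U"
    by (auto simp: open_contains_ball)
  then show "\<exists>V. open V \<and> 0 \<in> V \<and> V \<subseteq> U \<and>
      (\<forall>x\<in>V. \<forall>y\<in>V. \<forall>u\<ge>0. \<forall>v\<ge>0. u + v = 1 \<longrightarrow> u *\<^sub>R x + v *\<^sub>R y \<in> V)"
    using convex_ball[of "0::'a" e] unfolding convex_def
    by (intro exI[of _ "ball 0 e"]) auto
qed

text \<open>Elements of the topological dual are represented as functions into the reals, so that the
  pairing of \<open>l\<close> and \<open>y\<close> is the application \<open>l y\<close>.\<close>

definition topological_dual :: "('a::locally_convex_space \<Rightarrow> real) set" where
  "topological_dual = {l. linear l \<and> continuous_on UNIV l}"

text \<open>The weak* topology is the topology of pointwise convergence.\<close>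

definition weak_star_topology :: "('a::locally_convex_space \<Rightarrow> real) topology" where
  "weak_star_topology =
     subtopology (product_topology (\<lambda>_. euclideanreal) UNIV) topological_dual"

definition polar :: "'a::locally_convex_space set \<Rightarrow> ('a \<Rightarrow> real) set" where
  "polar C = {l \<in> topological_dual. \<forall>y\<in>C. l y \<le> 1}"

definition normal_cone :: "'a::locally_convex_space set \<Rightarrow> 'a \<Rightarrow> ('a \<Rightarrow> real) set" where
  "normal_cone C u = {l \<in> topological_dual. \<forall>y\<in>C. l (y - u) \<le> 0}"


section \<open>Extended-real-valued functions\<close>

definition effective_dom :: "('a \<Rightarrow> ereal) \<Rightarrow> 'a set" where
  "effective_dom f = {x. f x < \<infinity>}"

definition proper_fun :: "('a \<Rightarrow> ereal) \<Rightarrow> bool" where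
  "proper_fun f \<longleftrightarrow> (\<forall>x. f x \<noteq> -\<infinity>) \<and> effective_dom f \<noteq> {}"

text \<open>Only used for functions that do not take the value \<open>-\<infinity>\<close>, so the right-hand side is never
  an indeterminate sum.\<close>

definition convex_fun :: "('a::real_vector \<Rightarrow> ereal) \<Rightarrow> bool" where
  "convex_fun f \<longleftrightarrow>
     (\<forall>x y. \<forall>u>0. \<forall>v>0. u + v = 1 \<longrightarrow>
        f (u *\<^sub>R x + v *\<^sub>R y) \<le> ereal u * f x + ereal v * f y)"

definition lsc_fun :: "('a::topological_space \<Rightarrow> ereal) \<Rightarrow> bool" where
  "lsc_fun f \<longleftrightarrow> (\<forall>x c. c < f x \<longrightarrow> (\<forall>\<^sub>F y in nhds x. c < f y))"

definition Gamma0 :: "('a::locally_convex_space \<Rightarrow> ereal) set" where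
  "Gamma0 = {f. proper_fun f \<and> convex_fun f \<and> lsc_fun f}"

definition Gamma_fun ::
    "('a::locally_convex_space \<Rightarrow> ereal) \<Rightarrow> ('a \<Rightarrow> ereal) set" where
  "Gamma_fun h =
     {f. (\<forall>x. f x \<noteq> -\<infinity>) \<and> effective_dom f \<subseteq> effective_dom h \<and> (\<lambda>x. f x + h x) \<in> Gamma0}"

definition eps_subdiff ::
    "real \<Rightarrow> ('a::locally_convex_space \<Rightarrow> ereal) \<Rightarrow> 'a \<Rightarrow> ('a \<Rightarrow> real) set" where
  "eps_subdiff \<epsilon> f x =
     (if \<bar>f x\<bar> \<noteq> \<infinity>
      then {l \<in> topological_dual. \<forall>y. ereal (l (y - x)) \<le> f y - f x + ereal \<epsilon>}
      else {})"

abbreviation subdiff ::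
    "('a::locally_convex_space \<Rightarrow> ereal) \<Rightarrow> 'a \<Rightarrow> ('a \<Rightarrow> real) set" where
  "subdiff \<equiv> eps_subdiff 0"


section \<open>Vector-valued functions with an extra value\<close>

text \<open>A map from \<open>X\<close> to \<open>Y\<close> enlarged by an extra element is a partial map \<open>'a \<Rightarrow> 'b option\<close>,
  where \<^const>\<open>None\<close> is the extra element; its domain is \<^const>\<open>dom\<close>.\<close>

definition scalarization :: "('b \<Rightarrow> real) \<Rightarrow> ('a \<Rightarrow> 'b option) \<Rightarrow> 'a \<Rightarrow> ereal" where
  "scalarization l F x = (case F x of Some y \<Rightarrow> ereal (l y) | None \<Rightarrow> \<infinity>)"

definition Gamma_map ::
    "('a::locally_convex_space \<Rightarrow> ereal) \<Rightarrow> ('b::locally_convex_space \<Rightarrow> real) set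
      \<Rightarrow> ('a \<Rightarrow> 'b option) set" where
  "Gamma_map h B =
     {F. dom F \<subseteq> effective_dom h \<and> (\<forall>l\<in>B. (\<lambda>x. scalarization l F x + h x) \<in> Gamma0)}"

definition feasible :: "('a \<Rightarrow> 'b option) \<Rightarrow> 'b set \<Rightarrow> 'a \<Rightarrow> bool" where
  "feasible \<Phi> C x \<longleftrightarrow> (\<exists>y\<in>C. \<Phi> x = Some y)"

definition local_solution ::
    "('a::topological_space \<Rightarrow> ereal) \<Rightarrow> ('a \<Rightarrow> 'b option) \<Rightarrow> 'b set \<Rightarrow> 'a \<Rightarrow> bool" where
  "local_solution \<phi> \<Phi> C xbar \<longleftrightarrow>
     feasible \<Phi> C xbar \<and>
     (\<exists>U. open U \<and> xbar \<in> U \<and> (\<forall>x\<in>U. feasible \<Phi> C x \<longrightarrow> \<phi> xbar \<le> \<phi> x))"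


section \<open>Operations on sets of functionals\<close>

text \<open>The case distinction encodes the convention that zero times the empty set is the set
  consisting of the zero functional.\<close>

definition set_scale :: "real \<Rightarrow> ('a \<Rightarrow> real) set \<Rightarrow> ('a \<Rightarrow> real) set" where
  "set_scale c A = (if c = 0 then {\<lambda>_. 0} else (\<lambda>l x. c * l x) ` A)"

definition set_sum :: "('a \<Rightarrow> real) set \<Rightarrow> ('a \<Rightarrow> real) set \<Rightarrow> ('a \<Rightarrow> real) set" where
  "set_sum A B = {(\<lambda>x. l x + m x) | l m. l \<in> A \<and> m \<in> B}"

definition Delta2 :: "(real \<times> real) set" where
  "Delta2 = {(a1, a2). a1 \<in> {0..1} \<and> a2 \<in> {0..1} \<and> a1 + a2 = 1}"

end

theory Submission
  imports Defs
begin

text \<open>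
  Let \<open>x\<close> be feasible and close to \<open>xbar\<close>. Since \<open>h\<close> is continuous at \<open>xbar\<close>, it has a subgradient
  \<open>u\<close> at \<open>x\<close>, and this \<open>u\<close> is an \<open>\<eta>\<close>-subgradient of \<open>h\<close> at \<open>xbar\<close> for
  \<open>\<eta> = h xbar - h x + u (x - xbar)\<close>, that is, the \<open>\<eta>\<close>-subgradient inequality is an equality at \<open>x\<close>.
  The subgradients at all points near \<open>xbar\<close> are bounded by one constant on one neighbourhood of zero
  (lemma \<open>nearby_subgradients\<close>), so \<open>\<eta>\<close> is small and the inclusion hypothesis applies to \<open>u\<close>.
  Evaluating the resulting decomposition at \<open>x - xbar\<close>, all terms in \<open>h\<close>, \<open>\<eta>\<close> and \<open>l (\<Phi> xbar)\<close> cancel,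
  and what is left is
  \<open>0 \<le> \<alpha>1 * (\<phi> x - \<phi> xbar) + \<alpha>2 * (l (\<Phi> x) - 1)\<close>.
  As \<open>l\<close> is in the polar of \<open>C\<close> and \<open>\<Phi> x \<in> C\<close>, the second term is at most zero, and \<open>\<phi> xbar \<le> \<phi> x\<close>
  follows provided that \<open>\<alpha>1 > 0\<close>.

  The case \<open>\<alpha>1 = 0\<close> cannot occur near \<open>xbar\<close>. It gives
  \<open>u \<in> eps_subdiff \<eta>2 (\<langle>l, \<Phi>\<rangle> + h) xbar\<close> with \<open>\<eta>2\<close> and \<open>1 - l (\<Phi> xbar)\<close> both at most \<open>\<eta>\<close>. The
  functionals \<open>u\<close> lie in a pointwise compact set by the Banach-Alaoglu argument and the multipliers \<open>l\<close>
  in the weak* compact polar. If such pairs \<open>(u, l)\<close> existed for every \<open>\<eta> > 0\<close>, compactness would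
  therefore produce one for \<open>\<eta> = 0\<close>, against the qualification condition
  (lemma \<open>degenerate_multipliers_excluded\<close>).

  The existence of subgradients rests on the Hahn-Banach theorem, which is obtained from Zorn's lemma:
  a sublinear function that is minimal for the pointwise order is linear.
\<close>

section \<open>Sublinear functions and the Hahn-Banach theorem\<close>

definition sublinear_fun :: "('a::real_vector \<Rightarrow> real) \<Rightarrow> bool" where
  "sublinear_fun q \<longleftrightarrow>
     (\<forall>x y. q (x + y) \<le> q x + q y) \<and> (\<forall>c>0. \<forall>x. q (c *\<^sub>R x) = c * q x)"

lemma sublinear_fun_zero:
  assumes "sublinear_fun q"
  shows "q 0 = 0"
proof -
  have "q (2 *\<^sub>R 0) = 2 * q 0"
    using assms unfolding sublinear_fun_def by (metis zero_less_numeral)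
  then show ?thesis by simp
qed

text \<open>A common source of sublinear functions: pointwise infima of sets of numbers that are compatible
  with addition and scaling. An element of \<open>Q (- x)\<close> bounds \<open>Q x\<close> from below, because
  the two add up to something above an element of \<open>Q 0\<close>; so the infima are real numbers. It is used for
  translated differences of a sublinear function, for chains of sublinear functions, and for the
  difference quotients of a convex function.\<close>

lemma sublinear_fun_Inf:
  fixes Q :: "'a::real_vector \<Rightarrow> real set"
  assumes ne: "\<And>x. Q x \<noteq> {}"
    and add: "\<And>x y r s. r \<in> Q x \<Longrightarrow> s \<in> Q y \<Longrightarrow> \<exists>u\<in>Q (x + y). u \<le> r + s"
    and scale: "\<And>c x r. c > 0 \<Longrightarrow> r \<in> Q x \<Longrightarrow> c * r \<in> Q (c *\<^sub>R x)"
    and zero: "\<And>r. r \<in> Q 0 \<Longrightarrow> 0 \<le> r"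
  shows "sublinear_fun (\<lambda>x. Inf (Q x))"
    and "r \<in> Q x \<Longrightarrow> Inf (Q x) \<le> r"
proof -
  have bdd: "bdd_below (Q x)" for x
  proof -
    obtain s where s: "s \<in> Q (- x)" using ne by blast
    have "- s \<le> r" if "r \<in> Q x" for r
      using add[OF that s] zero by fastforce
    then show ?thesis by (rule bdd_belowI)
  qed
  have le: "Inf (Q x) \<le> r" if "r \<in> Q x" for r x
    by (rule cInf_lower[OF that bdd])
  show "r \<in> Q x \<Longrightarrow> Inf (Q x) \<le> r" by (rule le)
  have half: "Inf (Q (c *\<^sub>R x)) \<le> c * Inf (Q x)" if "c > 0" for c x
  proof -
    have "Inf (Q (c *\<^sub>R x)) / c \<le> r" if "r \<in> Q x" for r
      using le[OF scale[OF \<open>c > 0\<close> that]] \<open>c > 0\<close> by (simp add: field_simps)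
    then have "Inf (Q (c *\<^sub>R x)) / c \<le> Inf (Q x)"
      by (intro cInf_greatest ne)
    then show ?thesis using that by (simp add: field_simps)
  qed
  have "Inf (Q (x + y)) \<le> Inf (Q x) + Inf (Q y)" for x y
  proof -
    have 1: "Inf (Q (x + y)) - s \<le> r" if "r \<in> Q x" "s \<in> Q y" for r s
      using add[OF that] le by fastforce
    have "Inf (Q (x + y)) - Inf (Q x) \<le> s" if "s \<in> Q y" for s
      using cInf_greatest[OF ne, of x "Inf (Q (x + y)) - s"] 1 that by fastforce
    then have "Inf (Q (x + y)) - Inf (Q x) \<le> Inf (Q y)"
      by (intro cInf_greatest ne)
    then show ?thesis by simp
  qed
  moreover have "Inf (Q (c *\<^sub>R x)) = c * Inf (Q x)" if "c > 0" for c x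
  proof (rule antisym)
    have "Inf (Q ((1 / c) *\<^sub>R (c *\<^sub>R x))) \<le> (1 / c) * Inf (Q (c *\<^sub>R x))"
      using that by (intro half) simp
    then show "c * Inf (Q x) \<le> Inf (Q (c *\<^sub>R x))"
      using that by (simp add: field_simps)
  qed (rule half[OF that])
  ultimately show "sublinear_fun (\<lambda>x. Inf (Q x))"
    unfolding sublinear_fun_def by blast
qed

text \<open>For fixed \<open>a\<close>, the infimum over \<open>t \<ge> 0\<close> of \<open>q (x + t *\<^sub>R a) - t * q a\<close> is sublinear in \<open>x\<close> and
  lies below \<open>q\<close>, so by minimality it equals \<open>q\<close>. The choice \<open>t = 1\<close> then gives
  \<open>q x + q a \<le> q (x + a)\<close>, and \<open>q\<close> is additive.\<close>

lemma linear_of_minimal_sublinear: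
  fixes q :: "'a::real_vector \<Rightarrow> real"
  assumes q: "sublinear_fun q"
    and minimal: "\<And>q'. sublinear_fun q' \<Longrightarrow> q' \<le> q \<Longrightarrow> q' = q"
  shows "linear q"
proof -
  have sub: "q (x + y) \<le> q x + q y" for x y using q unfolding sublinear_fun_def by blast
  have hom: "q (c *\<^sub>R x) = c * q x" if "c \<ge> 0" for c x
    using q that sublinear_fun_zero[OF q] unfolding sublinear_fun_def
    by (cases "c = 0") auto
  have super: "q x + q a \<le> q (x + a)" for x a
  proof -
    define Q where "Q = (\<lambda>x. {q (x + t *\<^sub>R a) - t * q a | t. t \<ge> 0})"
    have Q_I: "q (x + t *\<^sub>R a) - t * q a \<in> Q x" if "t \<ge> 0" for x t
      using that unfolding Q_def by blast
    have Q_E: "\<exists>t\<ge>0. r = q (x + t *\<^sub>R a) - t * q a" if "r \<in> Q x" for x r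
      using that unfolding Q_def by blast
    have ne: "Q x \<noteq> {}" for x using Q_I[of 0 x] by auto
    have add: "\<exists>u\<in>Q (x + y). u \<le> r + s" if rs: "r \<in> Q x" "s \<in> Q y" for x y r s
    proof -
      obtain t t' where "t \<ge> 0" "t' \<ge> 0" and r: "r = q (x + t *\<^sub>R a) - t * q a"
        and s: "s = q (y + t' *\<^sub>R a) - t' * q a"
        using Q_E[OF rs(1)] Q_E[OF rs(2)] by blast
      moreover have "x + y + (t + t') *\<^sub>R a = (x + t *\<^sub>R a) + (y + t' *\<^sub>R a)"
        by (simp add: algebra_simps)
      ultimately show ?thesis
        using Q_I[of "t + t'" "x + y"] sub[of "x + t *\<^sub>R a" "y + t' *\<^sub>R a"]
        by (intro bexI[of _ "q (x + y + (t + t') *\<^sub>R a) - (t + t') * q a"])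
           (auto simp: algebra_simps)
    qed
    have scale: "c * r \<in> Q (c *\<^sub>R x)" if "c > 0" and r: "r \<in> Q x" for c x r
    proof -
      obtain t where t: "t \<ge> 0" "r = q (x + t *\<^sub>R a) - t * q a"
        using Q_E[OF r] by blast
      have "c * r = q (c *\<^sub>R (x + t *\<^sub>R a)) - (c * t) * q a"
        using t hom[of c "x + t *\<^sub>R a"] \<open>c > 0\<close> by (simp add: right_diff_distrib)
      also have "c *\<^sub>R (x + t *\<^sub>R a) = c *\<^sub>R x + (c * t) *\<^sub>R a"
        by (simp add: algebra_simps)
      finally show ?thesis using Q_I[of "c * t" "c *\<^sub>R x"] t \<open>c > 0\<close> by simp
    qed
    have zero: "0 \<le> r" if "r \<in> Q 0" for r
      using Q_E[OF that] hom by auto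
    note Inf = sublinear_fun_Inf[of Q, OF ne add scale zero]
    have "(\<lambda>x. Inf (Q x)) \<le> q"
      using Inf(2) Q_I[of 0] by (auto simp: le_fun_def)
    then have "(\<lambda>x. Inf (Q x)) = q" by (intro minimal Inf(1))
    moreover have "Inf (Q x) \<le> q (x + a) - q a"
      using Inf(2)[of _ x] Q_I[of 1 x] by simp
    ultimately show ?thesis by (metis le_diff_eq)
  qed
  then have add: "q (x + y) = q x + q y" for x y using sub by (simp add: antisym)
  have neg: "q (- x) = - q x" for x
    using add[of x "- x"] sublinear_fun_zero[OF q] by simp
  show ?thesis
  proof (rule linearI)
    show "q (c *\<^sub>R x) = c *\<^sub>R q x" for c x
    proof (cases "c \<ge> 0")
      case False
      then show ?thesis using hom[of "- c" x] neg[of "c *\<^sub>R x"] by simp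
    qed (simp add: hom)
  qed (rule add)
qed

text \<open>The Hahn-Banach theorem in its sublinear form. Chains of sublinear functions below \<open>p\<close> have
  sublinear pointwise infima, so a minimal one exists.\<close>

lemma sublinear_dominates_linear:
  fixes p :: "'a::real_vector \<Rightarrow> real"
  assumes p: "sublinear_fun p"
  shows "\<exists>l. linear l \<and> (\<forall>x. l x \<le> p x)"
proof -
  define S where "S = {q. sublinear_fun q \<and> q \<le> p}"
  have "\<exists>m\<in>S. \<forall>a\<in>S. a \<le> m \<longrightarrow> a = m"
  proof (rule predicate_Zorn[where P = "\<lambda>a b. b \<le> a"])
    show "partial_order_on S (relation_of (\<lambda>a b. b \<le> a) S)"
      by (rule partial_order_on_relation_ofI) auto
    fix \<C> assume ch: "\<C> \<in> Chains (relation_of (\<lambda>a b. b \<le> a) S)"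
    show "\<exists>u\<in>S. \<forall>a\<in>\<C>. u \<le> a"
    proof (cases "\<C> = {}")
      case True
      then show ?thesis using p unfolding S_def by auto
    next
      case False
      have CS: "q \<in> S" if "q \<in> \<C>" for q
        using ch that unfolding Chains_def relation_of_def by auto
      have tot: "q \<le> q' \<or> q' \<le> q" if "q \<in> \<C>" "q' \<in> \<C>" for q q'
        using ch that unfolding Chains_def relation_of_def by auto
      have sl: "sublinear_fun q" if "q \<in> \<C>" for q
        using CS[OF that] unfolding S_def by blast
      define Q where "Q = (\<lambda>x. {q x | q. q \<in> \<C>})"
      have ne: "Q x \<noteq> {}" for x using False unfolding Q_def by auto
      have add: "\<exists>u\<in>Q (x + y). u \<le> r + s" if rs: "r \<in> Q x" "s \<in> Q y" for x y r s
      proof -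
        obtain q q' where q: "q \<in> \<C>" "q' \<in> \<C>" "r = q x" "s = q' y"
          using rs unfolding Q_def by blast
        have "\<exists>m\<in>\<C>. m \<le> q \<and> m \<le> q'" using tot[OF q(1,2)] q(1,2) by blast
        then obtain m where m: "m \<in> \<C>" "m \<le> q" "m \<le> q'" by blast
        have "m (x + y) \<le> m x + m y" using sl[OF m(1)] unfolding sublinear_fun_def by blast
        also have "\<dots> \<le> r + s" using m q by (auto simp: le_fun_def intro: add_mono)
        finally show ?thesis using m(1) unfolding Q_def by blast
      qed
      have scale: "c * r \<in> Q (c *\<^sub>R x)" if c: "c > 0" and r: "r \<in> Q x" for c x r
      proof -
        obtain q where q: "q \<in> \<C>" "r = q x" using r unfolding Q_def by blast
        then have "c * r = q (c *\<^sub>R x)" using sl[OF q(1)] c unfolding sublinear_fun_def by auto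
        then show ?thesis using q(1) unfolding Q_def by blast
      qed
      have zero: "0 \<le> r" if "r \<in> Q 0" for r
        using that sl sublinear_fun_zero unfolding Q_def by fastforce
      note Inf = sublinear_fun_Inf[of Q, OF ne add scale zero]
      have below: "(\<lambda>x. Inf (Q x)) \<le> q" if "q \<in> \<C>" for q
        using Inf(2) that unfolding Q_def le_fun_def by blast
      moreover have "(\<lambda>x. Inf (Q x)) \<le> p"
        using below CS False unfolding S_def by (blast intro: order_trans)
      ultimately show ?thesis using Inf(1) unfolding S_def by blast
    qed
  qed
  then obtain m where m: "m \<in> S" "\<And>a. a \<in> S \<Longrightarrow> a \<le> m \<Longrightarrow> a = m" by blast
  then have "linear m"
    by (intro linear_of_minimal_sublinear) (auto simp: S_def intro: order_trans)
  then show ?thesis using m(1) by (auto simp: S_def le_fun_def)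
qed

section \<open>Neighbourhoods and functionals in locally convex spaces\<close>

lemma tendsto_scaleR_lcs:
  fixes g :: "'c \<Rightarrow> 'a::locally_convex_space"
  assumes "(f \<longlongrightarrow> a) F" "(g \<longlongrightarrow> b) F"
  shows "((\<lambda>x. f x *\<^sub>R g x) \<longlongrightarrow> a *\<^sub>R b) F"
  using filterlim_compose[OF tendsto_scaleR_nhds_Pair filterlim_Pair[OF assms]] by simp

text \<open>With \<open>c = 1\<close> this covers translates of \<open>W\<close>, with \<open>c = - 1\<close> and \<open>x = 0\<close> its reflection; below, these
  sets are written in this form.\<close>

lemma open_rescaled:
  fixes x :: "'a::locally_convex_space"
  assumes "open W"
  shows "open {y. c *\<^sub>R (y - x) \<in> W}"
proof -
  have "continuous_on UNIV (\<lambda>y. c *\<^sub>R (y - x))"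
    unfolding continuous_on_def
    by (auto intro!: tendsto_scaleR_lcs tendsto_diff tendsto_ident_at)
  from open_vimage[OF assms this] show ?thesis by (simp add: vimage_def)
qed

lemma absorbing_open:
  fixes d :: "'a::locally_convex_space"
  assumes "open W" "0 \<in> W"
  shows "\<exists>t>0. t *\<^sub>R d \<in> W"
proof -
  have "((\<lambda>t. t *\<^sub>R d) \<longlongrightarrow> 0 *\<^sub>R d) (at_right (0::real))"
    by (intro tendsto_scaleR_lcs) auto
  then have "\<forall>\<^sub>F t in at_right (0::real). t *\<^sub>R d \<in> W"
    using assms by (auto simp: tendsto_def)
  moreover have "\<forall>\<^sub>F t in at_right (0::real). t > 0"
    by (rule eventually_at_right_less)
  ultimately have "\<forall>\<^sub>F t in at_right (0::real). t > 0 \<and> t *\<^sub>R d \<in> W"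
    by eventually_elim auto
  from eventually_happens[OF this] show ?thesis by auto
qed

lemma linear_bounded_imp_dual:
  fixes l :: "'a::locally_convex_space \<Rightarrow> real"
  assumes l: "linear l" and W: "open W" "0 \<in> W" and bound: "\<And>w. w \<in> W \<Longrightarrow> \<bar>l w\<bar> \<le> M"
  shows "l \<in> topological_dual"
proof -
  have M: "M \<ge> 0" using bound[OF W(2)] by simp
  have "(l \<longlongrightarrow> l x) (at x)" for x
  proof (rule tendstoI)
    fix e :: real assume e: "e > 0"
    define c where "c = (M + 1) / e"
    have c: "c > 0" using M e by (simp add: c_def)
    have "\<forall>\<^sub>F y in at x. y \<in> {y. c *\<^sub>R (y - x) \<in> W}"
      using open_rescaled[OF W(1), of c x] W(2) by (intro topological_tendstoD[OF tendsto_ident_at]) auto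
    then show "\<forall>\<^sub>F y in at x. dist (l y) (l x) < e"
    proof eventually_elim
      case (elim y)
      then have "\<bar>c * (l y - l x)\<bar> \<le> M"
        using bound[of "c *\<^sub>R (y - x)"] l by (simp add: linear_diff linear_scale)
      then have "c * \<bar>l y - l x\<bar> < M + 1" using c by (simp add: abs_mult)
      also have "M + 1 = c * e" using e by (simp add: c_def)
      finally have "c * \<bar>l y - l x\<bar> < c * e" .
      then show ?case using c by (simp add: dist_real_def)
    qed
  qed
  then show ?thesis using l by (simp add: topological_dual_def continuous_on_def)
qed

text \<open>The Banach-Alaoglu theorem for the topology of pointwise convergence. Since \<open>W\<close> is absorbing, the
  functionals lie in a product of compact intervals, in which they are cut out by closed conditions.\<close>

lemma compact_bounded_functionals:
  fixes W :: "'a::locally_convex_space set"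
  assumes W: "open W" "0 \<in> W"
  shows "compact {l :: 'a \<Rightarrow> real. linear l \<and> (\<forall>w\<in>W. \<bar>l w\<bar> \<le> M)}"
proof -
  have "\<exists>B. \<forall>l :: 'a \<Rightarrow> real. linear l \<and> (\<forall>w\<in>W. \<bar>l w\<bar> \<le> M) \<longrightarrow> \<bar>l d\<bar> \<le> B" for d
  proof -
    obtain t where t: "t > 0" "t *\<^sub>R d \<in> W" using absorbing_open[OF W] by blast
    have "\<bar>l d\<bar> \<le> M / t" if "linear l" "\<forall>w\<in>W. \<bar>l w\<bar> \<le> M" for l :: "'a \<Rightarrow> real"
    proof -
      have "\<bar>t * l d\<bar> \<le> M" using that t(2) by (metis linear_scale real_scaleR_def)
      then show ?thesis using t(1) by (simp add: abs_mult field_simps)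
    qed
    then show ?thesis by blast
  qed
  then obtain B where B: "\<And>d (l :: 'a \<Rightarrow> real). linear l \<Longrightarrow> \<forall>w\<in>W. \<bar>l w\<bar> \<le> M \<Longrightarrow> \<bar>l d\<bar> \<le> B d"
    by metis
  define P where "P = PiE UNIV (\<lambda>d. {- B d..B d})"
  have "compactin (product_topology (\<lambda>_. euclideanreal) UNIV) P"
    unfolding P_def by (subst compactin_PiE) auto
  then have "compact P" by (simp add: euclidean_product_topology)
  moreover have "closed {l :: 'a \<Rightarrow> real. (\<forall>x y. l (x + y) = l x + l y) \<and>
      (\<forall>c x. l (c *\<^sub>R x) = c * l x) \<and> (\<forall>w\<in>W. \<bar>l w\<bar> \<le> M)}"
    unfolding Ball_def
    by (intro closed_Collect_conj closed_Collect_all closed_Collect_imp closed_Collect_eq closed_Collect_le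
        continuous_intros continuous_on_product_coordinates open_Collect_const)
  moreover have "{l. linear l \<and> (\<forall>w\<in>W. \<bar>l w\<bar> \<le> M)} = P \<inter> {l. (\<forall>x y. l (x + y) = l x + l y) \<and>
      (\<forall>c x. l (c *\<^sub>R x) = c * l x) \<and> (\<forall>w\<in>W. \<bar>l w\<bar> \<le> M)}"
    using B unfolding P_def by (auto simp: linear_iff abs_le_iff) (metis minus_le_iff)
  ultimately show ?thesis by (simp add: compact_Int_closed)
qed

section \<open>Existence and compactness of subgradients\<close>

text \<open>Replaces extended-real arithmetic by inequalities between real numbers at the points where
  \<open>f\<close> is finite.\<close>

lemma eps_subdiff_finite_iff:
  assumes "\<And>y. f y \<noteq> -\<infinity>" "f x \<noteq> \<infinity>"
  shows "l \<in> eps_subdiff \<epsilon> f x \<longleftrightarrow> l \<in> topological_dual \<and>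
    (\<forall>y. f y \<noteq> \<infinity> \<longrightarrow> l (y - x) \<le> real_of_ereal (f y) - real_of_ereal (f x) + \<epsilon>)"
proof -
  have *: "ereal (l (y - x)) \<le> f y - f x + ereal \<epsilon> \<longleftrightarrow>
      (f y \<noteq> \<infinity> \<longrightarrow> l (y - x) \<le> real_of_ereal (f y) - real_of_ereal (f x) + \<epsilon>)" for y
    using assms(1)[of x] assms(1)[of y] assms(2) by (cases "f x"; cases "f y") auto
  have "\<bar>f x\<bar> \<noteq> \<infinity>" using assms by auto
  then have "l \<in> eps_subdiff \<epsilon> f x \<longleftrightarrow>
      l \<in> topological_dual \<and> (\<forall>y. ereal (l (y - x)) \<le> f y - f x + ereal \<epsilon>)"
    by (simp add: eps_subdiff_def)
  then show ?thesis by (simp only: *)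
qed

lemma eps_subdiff_mono:
  assumes "\<epsilon> \<le> \<epsilon>'"
  shows "eps_subdiff \<epsilon> f x \<subseteq> eps_subdiff \<epsilon>' f x"
proof -
  have "f y - f x + ereal \<epsilon> \<le> f y - f x + ereal \<epsilon>'" for y
    using assms by (intro add_left_mono) simp
  then show ?thesis by (auto simp: eps_subdiff_def intro: order_trans)
qed

text \<open>The directional derivative of \<open>h\<close> at \<open>x\<close> is sublinear, and a linear functional below it is
  a subgradient. The upper bound on \<open>h\<close> near \<open>x\<close> makes the directional derivative real-valued and
  makes the functional continuous.\<close>

lemma subgradient_exists:
  fixes h :: "'a::locally_convex_space \<Rightarrow> ereal"
  assumes conv: "convex_fun h" and nm: "\<And>y. h y \<noteq> -\<infinity>"
    and W: "open W" "0 \<in> W" and bound: "\<And>w. w \<in> W \<Longrightarrow> h (x + w) \<le> ereal M"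
  shows "\<exists>l. l \<in> subdiff h x"
proof -
  have fin: "h x \<noteq> \<infinity>" using bound[OF W(2)] by auto
  then obtain k where k: "h x = ereal k" using nm[of x] by (cases "h x") auto
  \<comment> \<open>The infimum of \<open>Q d\<close> is the directional derivative in direction \<open>d\<close>. Taking all numbers above some
    difference quotient avoids dividing the possibly infinite values of \<open>h\<close>.\<close>
  define Q where "Q = (\<lambda>d. {r. \<exists>t>0. h (x + t *\<^sub>R d) \<le> ereal (k + t * r)})"
  have ne: "Q d \<noteq> {}" for d
  proof -
    obtain t where t: "t > 0" "t *\<^sub>R d \<in> W" using absorbing_open[OF W] by blast
    then have "h (x + t *\<^sub>R d) \<le> ereal (k + t * ((M - k) / t))" using bound by auto
    then show ?thesis using t unfolding Q_def by blast
  qed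
  have add: "\<exists>u\<in>Q (d + e). u \<le> r + s" if rs: "r \<in> Q d" "s \<in> Q e" for d e r s
  proof -
    obtain t where t: "t > 0" "h (x + t *\<^sub>R d) \<le> ereal (k + t * r)"
      using rs unfolding Q_def by blast
    obtain t' where t': "t' > 0" "h (x + t' *\<^sub>R e) \<le> ereal (k + t' * s)"
      using rs unfolding Q_def by blast
    \<comment> \<open>The convex combination in which the two steps \<open>t\<close> and \<open>t'\<close> become one common step \<open>a * t\<close>.\<close>
    define a where "a = t' / (t + t')"
    define b where "b = t / (t + t')"
    have ab: "a > 0" "b > 0" "a + b = 1" "a * t = b * t'"
      using t(1) t'(1) by (simp_all add: a_def b_def flip: add_divide_distrib)
    have "x + (a * t) *\<^sub>R (d + e) = (a + b) *\<^sub>R x + (a * t) *\<^sub>R d + (b * t') *\<^sub>R e"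
      using ab by (simp add: algebra_simps)
    also have "\<dots> = a *\<^sub>R (x + t *\<^sub>R d) + b *\<^sub>R (x + t' *\<^sub>R e)"
      by (simp add: algebra_simps)
    finally have "h (x + (a * t) *\<^sub>R (d + e)) \<le> ereal a * h (x + t *\<^sub>R d) + ereal b * h (x + t' *\<^sub>R e)"
      using conv ab unfolding convex_fun_def by metis
    also have "\<dots> \<le> ereal a * ereal (k + t * r) + ereal b * ereal (k + t' * s)"
      using t t' ab by (intro add_mono ereal_mult_left_mono) auto
    also have "\<dots> = ereal ((a + b) * k + (a * t) * r + (b * t') * s)"
      by (simp add: algebra_simps)
    also have "\<dots> = ereal (k + (a * t) * (r + s))"
      using ab by (simp add: algebra_simps)
    finally have "r + s \<in> Q (d + e)"
      using mult_pos_pos[OF ab(1) t(1)] unfolding Q_def by blast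
    then show ?thesis by blast
  qed
  have scale: "c * r \<in> Q (c *\<^sub>R d)" if c: "c > 0" and r: "r \<in> Q d" for c d r
  proof -
    obtain t where t: "t > 0" "h (x + t *\<^sub>R d) \<le> ereal (k + t * r)"
      using r unfolding Q_def by blast
    then show ?thesis using c unfolding Q_def by (auto intro!: exI[of _ "t / c"])
  qed
  have zero: "0 \<le> r" if "r \<in> Q 0" for r
    using that unfolding Q_def by (auto simp: k zero_le_mult_iff)
  note Inf = sublinear_fun_Inf[of Q, OF ne add scale zero]
  obtain l where l: "linear l" "\<And>d. l d \<le> Inf (Q d)"
    using sublinear_dominates_linear[OF Inf(1)] by blast
  have lr: "l (y - x) \<le> real_of_ereal (h y) - k" if y: "h y \<noteq> \<infinity>" for y
  proof -
    obtain r where r: "h y = ereal r" using y nm[of y] by (cases "h y") auto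
    then have "r - k \<in> Q (y - x)" unfolding Q_def by (auto intro!: exI[of _ 1])
    then show ?thesis using Inf(2) l(2)[of "y - x"] r by force
  qed
  have up: "l w \<le> M - k" if w: "w \<in> W" for w
  proof -
    obtain r where r: "h (x + w) = ereal r"
      using bound[OF w] nm[of "x + w"] by (cases "h (x + w)") auto
    then show ?thesis using lr[of "x + w"] bound[OF w] by simp
  qed
  define W' where "W' = W \<inter> {w. (-1) *\<^sub>R (w - 0) \<in> W}"
  have "l \<in> topological_dual"
  proof (rule linear_bounded_imp_dual[OF l(1), of W' "M - k"])
    show "open W'" unfolding W'_def by (intro open_Int W open_rescaled)
    show "0 \<in> W'" using W by (simp add: W'_def)
    show "\<bar>l w\<bar> \<le> M - k" if "w \<in> W'" for w
      using up[of w] up[of "- w"] that l(1) by (auto simp: W'_def linear_neg)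
  qed
  then show ?thesis using lr k eps_subdiff_finite_iff[of h x, OF nm fin] by auto
qed

lemma small_symmetric_nbhd:
  fixes V :: "'a::locally_convex_space set"
  assumes "open V" "0 \<in> V"
  obtains W where "open W" "0 \<in> W" "\<And>v w. v \<in> W \<Longrightarrow> w \<in> W \<Longrightarrow> v + w \<in> V"
    "\<And>w. w \<in> W \<Longrightarrow> - w \<in> W"
proof -
  have "\<forall>\<^sub>F p in nhds 0 \<times>\<^sub>F nhds (0::'a). fst p + snd p \<in> V"
    using tendsto_add_Pair[of "0::'a" 0] assms by (auto simp: tendsto_def)
  then obtain P Q where PQ: "eventually P (nhds 0)" "eventually Q (nhds (0::'a))"
    "\<And>x y. P x \<Longrightarrow> Q y \<Longrightarrow> x + y \<in> V"
    by (auto simp: eventually_prod_filter)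
  then have "\<forall>\<^sub>F x in nhds 0. P x \<and> Q x" by (simp add: eventually_conj)
  then obtain S where S: "open S" "0 \<in> S" "\<And>x. x \<in> S \<Longrightarrow> P x \<and> Q x"
    by (auto simp: eventually_nhds)
  define W where "W = S \<inter> {w. (-1) *\<^sub>R (w - 0) \<in> S}"
  have "open W" unfolding W_def by (intro open_Int S open_rescaled)
  then show ?thesis
    by (rule that) (use S PQ in \<open>auto simp: W_def\<close>)
qed

text \<open>Let \<open>h\<close> differ from \<open>h xbar\<close> by less than \<open>1\<close> near \<open>xbar\<close>. If \<open>x\<close> is close to \<open>xbar\<close> and \<open>w\<close> is small,
  then \<open>h (x + w)\<close> and \<open>h x\<close> differ by less than \<open>2\<close>, so every subgradient at \<open>x\<close> is bounded by \<open>2\<close> on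
  one neighbourhood of zero, independent of \<open>x\<close>. The error \<open>\<eta>\<close>, for which
  the subgradient at \<open>x\<close> is an \<open>\<eta>\<close>-subgradient at \<open>xbar\<close>, then tends to zero as \<open>x\<close> tends to \<open>xbar\<close>.\<close>

lemma nearby_subgradients:
  fixes h :: "'a::locally_convex_space \<Rightarrow> ereal"
  assumes conv: "convex_fun h" and nm: "\<And>y. h y \<noteq> -\<infinity>"
    and fin: "h xbar \<noteq> \<infinity>" and cont: "isCont h xbar"
  obtains K where "compact K" "K \<subseteq> topological_dual"
    "\<And>\<delta>. \<delta> > 0 \<Longrightarrow> \<exists>U. open U \<and> xbar \<in> U \<and> (\<forall>x\<in>U. h x \<noteq> \<infinity> \<and> (\<exists>u\<in>K. \<exists>\<eta>. 0 \<le> \<eta> \<and> \<eta> \<le> \<delta> \<and>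
       u \<in> eps_subdiff \<eta> h xbar \<and>
       u (x - xbar) = real_of_ereal (h x) - real_of_ereal (h xbar) + \<eta>))"
proof -
  obtain k where k: "h xbar = ereal k" using nm[of xbar] fin by (cases "h xbar") auto
  have near: "\<exists>U. open U \<and> xbar \<in> U \<and> (\<forall>x\<in>U. ereal (k - \<delta>) < h x \<and> h x < ereal (k + \<delta>))"
    if "\<delta> > 0" for \<delta>
    using cont[unfolded continuous_within_topological, rule_format,
        of "{ereal (k - \<delta>)<..<ereal (k + \<delta>)}"] that k by auto
  obtain U1 where U1: "open U1" "xbar \<in> U1"
      "\<And>x. x \<in> U1 \<Longrightarrow> ereal (k - 1) < h x \<and> h x < ereal (k + 1)"
    using near[of 1] by auto
  define V where "V = {v. 1 *\<^sub>R (v - (- xbar)) \<in> U1}"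
  have V: "open V" "0 \<in> V" unfolding V_def using U1(2) open_rescaled[OF U1(1)] by blast (simp add: U1(2))
  obtain W where W: "open W" "0 \<in> W" "\<And>v w. v \<in> W \<Longrightarrow> w \<in> W \<Longrightarrow> v + w \<in> V"
      "\<And>w. w \<in> W \<Longrightarrow> - w \<in> W"
    using small_symmetric_nbhd[OF V] by metis
  define K where "K = {l :: 'a \<Rightarrow> real. linear l \<and> (\<forall>w\<in>W. \<bar>l w\<bar> \<le> 2)}"
  show thesis
  proof (rule that[of K])
    show "compact K" unfolding K_def by (rule compact_bounded_functionals[OF W(1,2)])
    show "K \<subseteq> topological_dual"
      unfolding K_def using linear_bounded_imp_dual[OF _ W(1,2)] by blast
    fix \<delta> :: real assume "\<delta> > 0"
    \<comment> \<open>On \<open>U\<close> below, \<open>h xbar - h x < d\<close> and \<open>u (x - xbar) \<le> 2 * d\<close>, hence \<open>\<eta> \<le> 3 * d\<close>.\<close>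
    define d where "d = \<delta> / 3"
    have d: "d > 0" using \<open>\<delta> > 0\<close> by (simp add: d_def)
    obtain U2 where U2: "open U2" "xbar \<in> U2"
        "\<And>x. x \<in> U2 \<Longrightarrow> ereal (k - d) < h x \<and> h x < ereal (k + d)"
      using near[OF d] by auto
    define U where "U = U2 \<inter> {x. 1 *\<^sub>R (x - xbar) \<in> W} \<inter> {x. (1 / d) *\<^sub>R (x - xbar) \<in> W}"
    have "open U" unfolding U_def by (intro open_Int U2 open_rescaled W)
    moreover have "xbar \<in> U" using U2 W(2) by (simp add: U_def)
    moreover have "h x \<noteq> \<infinity> \<and> (\<exists>u\<in>K. \<exists>\<eta>. 0 \<le> \<eta> \<and> \<eta> \<le> \<delta> \<and> u \<in> eps_subdiff \<eta> h xbar \<and>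
        u (x - xbar) = real_of_ereal (h x) - real_of_ereal (h xbar) + \<eta>)" if x: "x \<in> U" for x
    proof -
      have xU2: "x \<in> U2" and xW: "x - xbar \<in> W" "(1 / d) *\<^sub>R (x - xbar) \<in> W"
        using x by (auto simp: U_def)
      obtain r where r: "h x = ereal r" using U2(3)[OF xU2] by (cases "h x") auto
      have rk: "k - d < r" "r < k + d" using U2(3)[OF xU2] r by auto
      have U1w: "ereal (k - 1) < h (x + w) \<and> h (x + w) < ereal (k + 1)" if "w \<in> W" for w
        using U1(3)[of "x + w"] W(3)[OF xW(1) that] by (simp add: V_def algebra_simps)
      obtain u where u: "u \<in> subdiff h x"
        using subgradient_exists[OF conv nm W(1,2), of x "k + 1"] U1w by (meson less_imp_le)
      have u_dual: "u \<in> topological_dual"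
        and u_le: "\<And>y. h y \<noteq> \<infinity> \<Longrightarrow> u (y - x) \<le> real_of_ereal (h y) - r"
        using u eps_subdiff_finite_iff[of h x u 0, OF nm] r by auto
      have lin: "linear u" using u_dual by (simp add: topological_dual_def)
      have up: "u w \<le> 2" if w: "w \<in> W" for w
      proof -
        obtain s where s: "h (x + w) = ereal s" using U1w[OF w] by (cases "h (x + w)") auto
        then show ?thesis using u_le[of "x + w"] U1w[OF w] U1w[OF W(2)] r by simp
      qed
      have bound: "\<bar>u w\<bar> \<le> 2" if "w \<in> W" for w
        using up[OF that] up[OF W(4)[OF that]] lin by (simp add: linear_neg)
      then have "u \<in> K" using lin by (simp add: K_def)
      define \<eta> where "\<eta> = u (x - xbar) - (r - k)"
      have "u (xbar - x) = - u (x - xbar)" using lin by (simp add: linear_diff)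
      then have "0 \<le> \<eta>" using u_le[of xbar] k by (simp add: \<eta>_def)
      moreover have "\<eta> \<le> \<delta>"
      proof -
        have "(1 / d) *\<^sub>R u (x - xbar) \<le> 2" using up[OF xW(2)] lin by (simp only: linear_scale)
        then have "u (x - xbar) \<le> 2 * d" using d by (simp add: field_simps)
        then show ?thesis using rk by (simp add: \<eta>_def d_def)
      qed
      moreover have "u \<in> eps_subdiff \<eta> h xbar"
      proof -
        have "u (y - xbar) \<le> real_of_ereal (h y) - k + \<eta>" if "h y \<noteq> \<infinity>" for y
          using u_le[OF that] lin by (simp add: \<eta>_def linear_diff)
        then show ?thesis using eps_subdiff_finite_iff[of h xbar, OF nm fin] k u_dual by simp
      qed
      moreover have "u (x - xbar) = real_of_ereal (h x) - real_of_ereal (h xbar) + \<eta>"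
        using r k by (simp add: \<eta>_def)
      moreover have "h x \<noteq> \<infinity>" using r by simp
      ultimately show ?thesis using \<open>u \<in> K\<close> by blast
    qed
    ultimately show "\<exists>U. open U \<and> xbar \<in> U \<and> (\<forall>x\<in>U. h x \<noteq> \<infinity> \<and> (\<exists>u\<in>K. \<exists>\<eta>. 0 \<le> \<eta> \<and> \<eta> \<le> \<delta> \<and>
       u \<in> eps_subdiff \<eta> h xbar \<and>
       u (x - xbar) = real_of_ereal (h x) - real_of_ereal (h xbar) + \<eta>))" by blast
  qed
qed

section \<open>Excluding multipliers that ignore the objective\<close>

lemma eps_subdiff_scalarization_iff:
  fixes \<Phi> :: "'a::locally_convex_space \<Rightarrow> 'b option"
  assumes nm: "\<And>y. h y \<noteq> -\<infinity>" and dom: "dom \<Phi> \<subseteq> effective_dom h" and x: "\<Phi> x = Some y0"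
  shows "u \<in> eps_subdiff \<epsilon> (\<lambda>x. scalarization l \<Phi> x + h x) x \<longleftrightarrow> u \<in> topological_dual \<and>
    (\<forall>y\<in>dom \<Phi>. u (y - x) \<le> l (the (\<Phi> y)) + real_of_ereal (h y) - l y0 - real_of_ereal (h x) + \<epsilon>)"
proof -
  have fin: "\<exists>r. h y = ereal r" if "y \<in> dom \<Phi>" for y
    using subsetD[OF dom that] nm[of y] by (cases "h y") (auto simp: effective_dom_def)
  have "scalarization l \<Phi> y + h y \<noteq> -\<infinity>" for y
    using nm[of y] by (cases "h y") (auto simp: scalarization_def split: option.split)
  moreover have inf: "scalarization l \<Phi> y + h y \<noteq> \<infinity> \<longleftrightarrow> y \<in> dom \<Phi>" for y
    using nm[of y] fin[of y] by (cases "h y") (auto simp: scalarization_def split: option.split)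
  moreover have val: "real_of_ereal (scalarization l \<Phi> y + h y) = l (the (\<Phi> y)) + real_of_ereal (h y)"
    if "y \<in> dom \<Phi>" for y
    using fin[OF that] that by (auto simp: scalarization_def)
  moreover have "x \<in> dom \<Phi>" using x by auto
  ultimately show ?thesis
    by (subst eps_subdiff_finite_iff) (auto simp: x algebra_simps Ball_def)
qed

text \<open>The qualification condition excludes exact pairs \<open>(u, l)\<close>; by compactness it excludes approximate
  pairs as well. For each \<open>\<epsilon> > 0\<close>, the pairs in \<open>K \<times> L\<close> that satisfy the conditions up to \<open>\<epsilon>\<close> form a
  compact set, and these sets shrink as \<open>\<epsilon>\<close> does. If none of them were empty, they would have a
  common element, which satisfies the conditions exactly.\<close>

lemma degenerate_multipliers_excluded:
  fixes h :: "'a::locally_convex_space \<Rightarrow> ereal" and \<Phi> :: "'a \<Rightarrow> 'b option"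
  assumes K: "compact K" "K \<subseteq> topological_dual" and L: "compact L"
    and nm: "\<And>y. h y \<noteq> -\<infinity>" and dom: "dom \<Phi> \<subseteq> effective_dom h" and x: "\<Phi> xbar = Some y0"
    and none: "\<And>u l. u \<in> K \<Longrightarrow> l \<in> L \<Longrightarrow> 1 \<le> l y0 \<Longrightarrow> u \<in> subdiff h xbar \<Longrightarrow>
      u \<notin> subdiff (\<lambda>x. scalarization l \<Phi> x + h x) xbar"
  shows "\<exists>\<epsilon>>0. \<forall>u\<in>K. \<forall>l\<in>L. 1 - \<epsilon> \<le> l y0 \<longrightarrow> u \<in> eps_subdiff \<epsilon> h xbar \<longrightarrow>
      u \<notin> eps_subdiff \<epsilon> (\<lambda>x. scalarization l \<Phi> x + h x) xbar"
proof -
  have fin: "h xbar \<noteq> \<infinity>" using subsetD[OF dom, of xbar] x by (auto simp: effective_dom_def)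
  note sub_h = eps_subdiff_finite_iff[of h xbar, OF nm fin]
  note sub_\<Phi> = eps_subdiff_scalarization_iff[of h, OF nm dom x]
  define T where "T = (\<lambda>\<epsilon>. {p :: ('a \<Rightarrow> real) \<times> ('b \<Rightarrow> real). 1 - \<epsilon> \<le> snd p y0 \<and>
    (\<forall>y. h y \<noteq> \<infinity> \<longrightarrow> fst p (y - xbar) \<le> real_of_ereal (h y) - real_of_ereal (h xbar) + \<epsilon>) \<and>
    (\<forall>y. y \<in> dom \<Phi> \<longrightarrow> fst p (y - xbar) \<le>
      snd p (the (\<Phi> y)) + real_of_ereal (h y) - snd p y0 - real_of_ereal (h xbar) + \<epsilon>)})"
  have T_iff: "(u, l) \<in> T \<epsilon> \<longleftrightarrow> 1 - \<epsilon> \<le> l y0 \<and> u \<in> eps_subdiff \<epsilon> h xbar \<and>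
      u \<in> eps_subdiff \<epsilon> (\<lambda>x. scalarization l \<Phi> x + h x) xbar" if "u \<in> K" for u l \<epsilon>
    using that K(2) by (auto simp: T_def sub_h sub_\<Phi>)
  have mono: "T \<epsilon> \<subseteq> T \<epsilon>'" if "\<epsilon> \<le> \<epsilon>'" for \<epsilon> \<epsilon>'
    using that unfolding T_def by (fastforce intro: order_trans)
  have ev: "continuous_on UNIV (\<lambda>p :: ('a \<Rightarrow> real) \<times> ('b \<Rightarrow> real). fst p a)"
    "continuous_on UNIV (\<lambda>p :: ('a \<Rightarrow> real) \<times> ('b \<Rightarrow> real). snd p b)" for a b
    by (rule continuous_on_product_then_coordinatewise, rule continuous_on_fst continuous_on_snd,
        rule continuous_on_id)+
  have closed: "closed (T \<epsilon>)" for \<epsilon>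
    unfolding T_def
    by (intro closed_Collect_conj closed_Collect_all closed_Collect_imp closed_Collect_le
        open_Collect_const continuous_intros ev)
  have "\<exists>\<epsilon>>0. (K \<times> L) \<inter> T \<epsilon> = {}"
  proof (rule ccontr)
    assume "\<not> ?thesis"
    then have meet: "(K \<times> L) \<inter> T \<epsilon> \<noteq> {}" if "\<epsilon> > 0" for \<epsilon> using that by blast
    have "(K \<times> L) \<inter> (\<Inter>\<epsilon>\<in>{0<..}. T \<epsilon>) \<noteq> {}"
    proof (rule compact_imp_fip_image[OF compact_Times[OF K(1) L] closed])
      fix I :: "real set" assume I: "finite I" "I \<subseteq> {0<..}"
      define m where "m = Min (insert 1 I)"
      have "m > 0" "\<And>\<epsilon>. \<epsilon> \<in> I \<Longrightarrow> m \<le> \<epsilon>" using I by (auto simp: m_def)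
      then show "(K \<times> L) \<inter> (\<Inter>\<epsilon>\<in>I. T \<epsilon>) \<noteq> {}" using meet[of m] mono[of m] by blast
    qed
    then obtain u l where ul: "u \<in> K" "l \<in> L" "\<And>\<epsilon>. \<epsilon> > 0 \<Longrightarrow> (u, l) \<in> T \<epsilon>" by auto
    have lim: "a \<le> b" if "\<And>\<epsilon>. \<epsilon> > 0 \<Longrightarrow> a \<le> b + \<epsilon>" for a b :: real
      using that by (rule field_le_epsilon)
    have "1 \<le> l y0"
      by (rule lim) (use ul(3) in \<open>force simp: T_def\<close>)
    moreover have "u (y - xbar) \<le> real_of_ereal (h y) - real_of_ereal (h xbar)" if "h y \<noteq> \<infinity>" for y
      by (rule lim) (use ul(3) that in \<open>auto simp: T_def\<close>)
    moreover have "u (y - xbar) \<le> l (the (\<Phi> y)) + real_of_ereal (h y) - l y0 - real_of_ereal (h xbar)"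
      if "y \<in> dom \<Phi>" for y
      by (rule lim) (use ul(3) that in \<open>simp add: T_def\<close>)
    ultimately have "(u, l) \<in> T 0" by (simp add: T_def)
    then show False using none[OF ul(1,2)] T_iff[OF ul(1)] by auto
  qed
  then obtain \<epsilon> where "\<epsilon> > 0" "(K \<times> L) \<inter> T \<epsilon> = {}" by blast
  then show ?thesis using T_iff by blast
qed

section \<open>Sufficiency of the subdifferential inclusion\<close>

lemma compact_of_weak_star_compact:
  assumes "compactin weak_star_topology A"
  shows "compact A"
  using assms by (simp add: weak_star_topology_def compactin_subtopology euclidean_product_topology)

theorem theorem3p11:
  fixes C :: "'b::locally_convex_space set"
    and h \<phi> :: "'a::locally_convex_space \<Rightarrow> ereal"
    and \<Phi> :: "'a \<Rightarrow> 'b option"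
    and xbar :: 'a
  assumes "C \<noteq> {}" and "closed C" and "convex C"
    and "compactin weak_star_topology (polar C)"
    and "h \<in> Gamma0"
    and "\<phi> \<in> Gamma_fun h"
    and "\<Phi> \<in> Gamma_map h (polar C)"
    and "feasible \<Phi> C xbar"
    and "\<exists>\<eta>0>0. \<forall>\<eta>. 0 \<le> \<eta> \<and> \<eta> \<le> \<eta>0 \<longrightarrow>
      eps_subdiff \<eta> h xbar \<subseteq>
        \<Union> {set_sum
              (set_scale \<alpha>1 (eps_subdiff \<eta>1 (\<lambda>x. \<phi> x + h x) xbar))
              (set_scale \<alpha>2 (eps_subdiff \<eta>2 (\<lambda>x. scalarization l \<Phi> x + h x) xbar))
            | \<eta>1 \<eta>2 \<alpha>1 \<alpha>2 l.
              \<eta>1 \<ge> 0 \<and> \<eta>2 \<ge> 0 \<and> (\<alpha>1, \<alpha>2) \<in> Delta2 \<and> l \<in> polar C \<and>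
              \<alpha>1 * \<eta>1 + \<alpha>2 * (\<eta>2 + 1 - l (the (\<Phi> xbar))) = \<eta>}"
    and "isCont h xbar"
    and "subdiff h xbar \<inter>
        \<Union> {subdiff (\<lambda>x. scalarization l \<Phi> x + h x) xbar
            | l. l \<in> normal_cone C (the (\<Phi> xbar)) \<and> l (the (\<Phi> xbar)) = 1} = {}"
  shows "local_solution \<phi> \<Phi> C xbar"
proof -
  obtain y0 where y0: "y0 \<in> C" "\<Phi> xbar = Some y0"
    using assms(8) by (auto simp: feasible_def)
  have conv: "convex_fun h" and nm: "\<And>y. h y \<noteq> -\<infinity>"
    using assms(5) by (auto simp: Gamma0_def proper_fun_def)
  have dom: "dom \<Phi> \<subseteq> effective_dom h" using assms(7) by (simp add: Gamma_map_def)
  have \<phi>nm: "\<And>y. \<phi> y \<noteq> -\<infinity>" using assms(6) by (simp add: Gamma_fun_def)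
  have fin: "h xbar \<noteq> \<infinity>" using subsetD[OF dom, of xbar] y0 by (auto simp: effective_dom_def)
  then obtain k where k: "h xbar = ereal k" using nm[of xbar] by (cases "h xbar") auto
  note sub_\<Phi> = eps_subdiff_scalarization_iff[of h, OF nm dom y0(2)]
  obtain K where K: "compact K" "K \<subseteq> topological_dual" and
    near: "\<And>\<delta>. \<delta> > 0 \<Longrightarrow> \<exists>U. open U \<and> xbar \<in> U \<and> (\<forall>x\<in>U. h x \<noteq> \<infinity> \<and> (\<exists>u\<in>K. \<exists>\<eta>. 0 \<le> \<eta> \<and> \<eta> \<le> \<delta> \<and>
       u \<in> eps_subdiff \<eta> h xbar \<and>
       u (x - xbar) = real_of_ereal (h x) - real_of_ereal (h xbar) + \<eta>))"
    by (rule nearby_subgradients[of h xbar, OF conv nm fin assms(10)]) blast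
  \<comment> \<open>An \<open>l\<close> in the polar with \<open>l y0 = 1\<close> attains its maximum over \<open>C\<close> at \<open>y0\<close>, so it is normal to \<open>C\<close>.\<close>
  have QC: "u \<notin> subdiff (\<lambda>x. scalarization l \<Phi> x + h x) xbar"
    if "l \<in> polar C" "1 \<le> l y0" "u \<in> subdiff h xbar" for u l
  proof -
    have l: "l \<in> topological_dual" "\<And>y. y \<in> C \<Longrightarrow> l y \<le> 1" using that by (auto simp: polar_def)
    have 1: "l y0 = 1" using l(2)[OF y0(1)] that(2) by simp
    then have "l \<in> normal_cone C y0"
      using l by (auto simp: normal_cone_def topological_dual_def linear_diff)
    then show ?thesis using assms(11) that(3) 1 y0(2) by auto
  qed
  have "\<exists>\<epsilon>>0. \<forall>u\<in>K. \<forall>l\<in>polar C. 1 - \<epsilon> \<le> l y0 \<longrightarrow> u \<in> eps_subdiff \<epsilon> h xbar \<longrightarrow>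
      u \<notin> eps_subdiff \<epsilon> (\<lambda>x. scalarization l \<Phi> x + h x) xbar"
  proof (rule degenerate_multipliers_excluded[OF K compact_of_weak_star_compact[OF assms(4)] nm dom y0(2)])
    show "u \<notin> subdiff (\<lambda>x. scalarization l \<Phi> x + h x) xbar"
      if "l \<in> polar C" "1 \<le> l y0" "u \<in> subdiff h xbar" for u l
      by (rule QC[OF that])
  qed
  then obtain \<epsilon> where \<epsilon>: "\<epsilon> > 0" "\<And>u l. u \<in> K \<Longrightarrow> l \<in> polar C \<Longrightarrow> 1 - \<epsilon> \<le> l y0 \<Longrightarrow>
      u \<in> eps_subdiff \<epsilon> h xbar \<Longrightarrow> u \<notin> eps_subdiff \<epsilon> (\<lambda>x. scalarization l \<Phi> x + h x) xbar"
    by blast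
  \<comment> \<open>The right-hand side of the inclusion hypothesis.\<close>
  define G where "G \<eta> = \<Union> {set_sum
              (set_scale \<alpha>1 (eps_subdiff \<eta>1 (\<lambda>x. \<phi> x + h x) xbar))
              (set_scale \<alpha>2 (eps_subdiff \<eta>2 (\<lambda>x. scalarization l \<Phi> x + h x) xbar))
            | \<eta>1 \<eta>2 \<alpha>1 \<alpha>2 l.
              \<eta>1 \<ge> 0 \<and> \<eta>2 \<ge> 0 \<and> (\<alpha>1, \<alpha>2) \<in> Delta2 \<and> l \<in> polar C \<and>
              \<alpha>1 * \<eta>1 + \<alpha>2 * (\<eta>2 + 1 - l y0) = \<eta>}" for \<eta>
  obtain \<eta>0 where \<eta>0: "\<eta>0 > 0"
    and incl: "\<And>\<eta>. 0 \<le> \<eta> \<Longrightarrow> \<eta> \<le> \<eta>0 \<Longrightarrow> eps_subdiff \<eta> h xbar \<subseteq> G \<eta>"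
    using assms(9)[unfolded y0(2) option.sel, folded G_def] by blast
  have "min \<epsilon> \<eta>0 > 0" using \<epsilon>(1) \<eta>0 by simp
  from near[OF this] obtain U where U: "open U" "xbar \<in> U" and near_U: "\<And>x. x \<in> U \<Longrightarrow> h x \<noteq> \<infinity> \<and>
      (\<exists>u\<in>K. \<exists>\<eta>. 0 \<le> \<eta> \<and> \<eta> \<le> min \<epsilon> \<eta>0 \<and> u \<in> eps_subdiff \<eta> h xbar \<and>
       u (x - xbar) = real_of_ereal (h x) - real_of_ereal (h xbar) + \<eta>)"
    by blast
  have "\<phi> xbar \<le> \<phi> x" if x: "x \<in> U" "feasible \<Phi> C x" for x
  proof -
    obtain y where y: "y \<in> C" "\<Phi> x = Some y" using x(2) by (auto simp: feasible_def)
    obtain r where r: "h x = ereal r" using near_U[OF x(1)] nm[of x] by (cases "h x") auto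
    obtain u \<eta> where u: "u \<in> K" "0 \<le> \<eta>" "\<eta> \<le> \<epsilon>" "\<eta> \<le> \<eta>0" "u \<in> eps_subdiff \<eta> h xbar"
      "u (x - xbar) = r - k + \<eta>"
      using near_U[OF x(1), unfolded r k min.bounded_iff real_of_ereal.simps] by blast
    obtain \<eta>1 \<eta>2 \<alpha>1 \<alpha>2 l where u_sum: "u \<in> set_sum
          (set_scale \<alpha>1 (eps_subdiff \<eta>1 (\<lambda>x. \<phi> x + h x) xbar))
          (set_scale \<alpha>2 (eps_subdiff \<eta>2 (\<lambda>x. scalarization l \<Phi> x + h x) xbar))"
      and \<eta>12: "\<eta>1 \<ge> 0" "\<eta>2 \<ge> 0" and \<Delta>: "(\<alpha>1, \<alpha>2) \<in> Delta2" and l: "l \<in> polar C"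
      and \<eta>: "\<alpha>1 * \<eta>1 + \<alpha>2 * (\<eta>2 + 1 - l y0) = \<eta>"
      using subsetD[OF incl[OF u(2,4)] u(5)] unfolding G_def by blast
    have \<alpha>: "\<alpha>1 \<ge> 0" "\<alpha>2 \<ge> 0" "\<alpha>1 + \<alpha>2 = 1" using \<Delta> by (auto simp: Delta2_def)
    have l1: "l y \<le> 1" "l y0 \<le> 1" using l y(1) y0(1) by (auto simp: polar_def)
    obtain v w where vw: "u = (\<lambda>x. v x + w x)"
      and v: "v \<in> set_scale \<alpha>1 (eps_subdiff \<eta>1 (\<lambda>x. \<phi> x + h x) xbar)"
      and w: "w \<in> set_scale \<alpha>2 (eps_subdiff \<eta>2 (\<lambda>x. scalarization l \<Phi> x + h x) xbar)"
      using u_sum by (auto simp: set_sum_def)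
    have w_le: "w (x - xbar) \<le> \<alpha>2 * (l y + r - l y0 - k + \<eta>2)"
    proof (cases "\<alpha>2 = 0")
      case False
      then obtain w' where w': "w = (\<lambda>x. \<alpha>2 * w' x)"
          "w' \<in> eps_subdiff \<eta>2 (\<lambda>x. scalarization l \<Phi> x + h x) xbar"
        using w by (auto simp: set_scale_def)
      have "w' (x - xbar) \<le> l y + r - l y0 - k + \<eta>2"
        using bspec[OF conjunct2[OF iffD1[OF sub_\<Phi> w'(2)]], of x] y(2) r k by auto
      then show ?thesis using w'(1) \<alpha>(2) by (simp add: mult_left_mono)
    qed (use w in \<open>simp add: set_scale_def\<close>)
    \<comment> \<open>If \<open>\<alpha>1 = 0\<close>, then \<open>u\<close> is one of the functionals excluded by the choice of \<open>\<epsilon>\<close>.\<close>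
    show ?thesis
    proof (cases "\<alpha>1 = 0")
      case True
      then have "\<alpha>2 = 1" using \<alpha>(3) by simp
      then have "u \<in> eps_subdiff \<eta>2 (\<lambda>x. scalarization l \<Phi> x + h x) xbar"
        using True v w vw by (auto simp: set_scale_def)
      moreover have "\<eta>2 \<le> \<epsilon>" "1 - \<epsilon> \<le> l y0" using \<eta> True \<open>\<alpha>2 = 1\<close> \<eta>12 l1 u(3) by auto
      moreover have "u \<in> eps_subdiff \<epsilon> h xbar"
        using u(3,5) eps_subdiff_mono by blast
      ultimately have False using \<epsilon>(2)[OF u(1) l] eps_subdiff_mono by blast
      then show ?thesis ..
    next
      case False
      then obtain v' where v': "v = (\<lambda>x. \<alpha>1 * v' x)" "v' \<in> eps_subdiff \<eta>1 (\<lambda>x. \<phi> x + h x) xbar"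
        using v by (auto simp: set_scale_def)
      obtain a where a: "\<phi> xbar = ereal a"
        using v'(2) k \<phi>nm[of xbar] by (cases "\<phi> xbar") (auto simp: eps_subdiff_def)
      show ?thesis
      proof (cases "\<phi> x")
        case (real b)
        have "ereal (v' (x - xbar)) \<le> (\<phi> x + h x) - (\<phi> xbar + h xbar) + ereal \<eta>1"
          using v'(2) by (auto simp: eps_subdiff_def split: if_splits)
        then have "v' (x - xbar) \<le> b + r - (a + k) + \<eta>1" using real r a k by simp
        then have "v (x - xbar) \<le> \<alpha>1 * (b + r - (a + k) + \<eta>1)"
          using v'(1) \<alpha>(1) by (simp add: mult_left_mono)
        then have "r - k + \<eta> \<le> \<alpha>1 * (b + r - (a + k) + \<eta>1) + \<alpha>2 * (l y + r - l y0 - k + \<eta>2)"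
          using w_le u(6) vw by simp
        also have "\<dots> = \<alpha>1 * (b - a) + \<alpha>2 * (l y - 1) + (\<alpha>1 + \<alpha>2) * (r - k) + \<eta>"
          unfolding \<eta>[symmetric] by (simp add: algebra_simps)
        finally have "0 \<le> \<alpha>1 * (b - a) + \<alpha>2 * (l y - 1)" using \<alpha>(3) by simp
        moreover have "\<alpha>2 * (l y - 1) \<le> 0" using \<alpha>(2) l1(1) by (simp add: mult_nonneg_nonpos)
        ultimately have "0 \<le> \<alpha>1 * (b - a)" by simp
        then show ?thesis using False \<alpha>(1) real a by (simp add: zero_le_mult_iff)
      qed (use \<phi>nm in auto)
    qed
  qed
  then show ?thesis using U assms(8) unfolding local_solution_def by blast
qed

end
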